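(* Let $\langle\cdot,\cdot\rangle$ be a sequentially-ordered discrete Sobolev inner product $$\langle f,g \rangle= \int_{-1}^{1} f(x) g(x) \,d\mu(x) +\sum_{j=1}^{N} \eta_{j,d_j} \,f^{(d_j)}(c_{j})\, g^{(d_j)}(c_{j}),$$ and for $n\ge 0$ let $S_n$ be the monic polynomial of degree $n$ with $\langle x^k,S_n\rangle=0$ for $k=0,1,\dots,n-1$. Then $S_n$ has at least $n-N$ changes of sign on $(-1,1)$.
   Context: $\mu$ is a finite positive Borel measure with $\operatorname{supp}\mu\subset[-1,1]$ containing infinitely many points; $N\ge 0$ is an integer, $\eta_{j,d_j}>0$, $c_j\in\mathbb{R}\setminus[-1,1]$, and $d_j\in\mathbb{Z}_+=\{0,1,2,\dots\}$ for $j=1,\dots,N$; $f^{(i)}$ is the $i$-th derivative of $f$. The polynomial $S_n$ exists and is unique for each $n$. Sequentially-ordered: the inner product is called sequentially-ordered if the pairs $(c_j,d_j)$, $1\le j\le N$, can be arranged into a finite sequence $(r_1,\nu_1),\dots,(r_N,\nu_N)$ such that (1) $0\le \nu_1\le\nu_2\le\cdots\le\nu_N$, and (2) for each $k=1,\dots,N$, $r_k$ does not belong to the convex hull of $(-1,1)\cup\{r_1,\dots,r_{k-1}\}$. *)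

theory Defs
  imports "HOL-Analysis.Analysis" "HOL-Computational_Algebra.Polynomial"
begin

definition measure_supp :: "'a::topological_space measure \<Rightarrow> 'a set" where
  "measure_supp M = {x. \<forall>U. open U \<and> x \<in> U \<longrightarrow> emeasure M U > 0}"

definition sobolev_inner ::
  "real measure \<Rightarrow> nat \<Rightarrow> (nat \<Rightarrow> real) \<Rightarrow> (nat \<Rightarrow> real) \<Rightarrow> (nat \<Rightarrow> nat) \<Rightarrow>
    real poly \<Rightarrow> real poly \<Rightarrow> real" where
  "sobolev_inner \<mu> N \<eta> c d f g =
     (LINT x:{-1..1}|\<mu>. poly f x * poly g x) +
     (\<Sum>j=1..N. \<eta> j * poly ((pderiv ^^ d j) f) (c j) * poly ((pderiv ^^ d j) g) (c j))"

text \<open>The arranged sequence is \<open>(r\<^sub>k, \<nu>\<^sub>k) = (c (\<sigma> k), d (\<sigma> k))\<close> for a permutation \<open>\<sigma>\<close> of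
  \<open>{1..N}\<close>.\<close>

definition sequentially_ordered :: "nat \<Rightarrow> (nat \<Rightarrow> real) \<Rightarrow> (nat \<Rightarrow> nat) \<Rightarrow> bool" where
  "sequentially_ordered N c d \<longleftrightarrow>
     (\<exists>\<sigma>. bij_betw \<sigma> {1..N} {1..N} \<and>
        mono_on {1..N} (\<lambda>k. d (\<sigma> k)) \<and>
        (\<forall>k\<in>{1..N}. c (\<sigma> k) \<notin> convex hull ({-1<..<1} \<union> (\<lambda>i. c (\<sigma> i)) ` {1..<k})))"

definition changes_sign_at :: "(real \<Rightarrow> real) \<Rightarrow> real \<Rightarrow> bool" where
  "changes_sign_at f x \<longleftrightarrow>
     (\<exists>\<epsilon>>0. \<forall>y\<in>{x-\<epsilon><..<x}. \<forall>z\<in>{x<..<x+\<epsilon>}. f y * f z < 0)"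

text \<open>Only meaningful for functions with finitely many sign changes on \<open>A\<close>, such as nonzero
  polynomials: the cardinality of an infinite set is \<open>0\<close>.\<close>

definition num_sign_changes :: "(real \<Rightarrow> real) \<Rightarrow> real set \<Rightarrow> nat" where
  "num_sign_changes f A = card {x \<in> A. changes_sign_at f x}"

end

theory Submission imports Defs begin

text \<open>
  Suppose that \<open>S\<close> has only \<open>m < n - N\<close> changes of sign on \<open>(-1, 1)\<close>. The contradiction comes
  from a nonzero polynomial \<open>Q\<close> of degree at most \<open>m + N < n\<close> that changes sign on \<open>(-1, 1)\<close>
  exactly where \<open>S\<close> does and whose derivatives of order \<open>d j\<close> vanish at \<open>c j\<close>. Then \<open>Q * S\<close>
  has constant sign on \<open>[-1, 1]\<close> and the discrete part of the inner product of \<open>Q\<close> and \<open>S\<close> is zero,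
  so the inner product is a nonzero integral; but \<open>S\<close> is orthogonal to all polynomials of degree
  below \<open>n\<close>.

  The conditions \<open>Q = 0\<close> at the \<open>m\<close> points together with the \<open>N\<close> derivative conditions are
  \<open>m + N\<close> linear equations, so a solution of degree at most \<open>m + N\<close> exists
  (\<open>common_kernel_degree_bound\<close>). The danger is that \<open>Q\<close> has further roots on \<open>(-1, 1)\<close>, or
  multiple ones. Here sequential ordering enters: by Rolle's theorem, applied one derivative at a
  time, each condition of order less than \<open>degree Q\<close> costs one root on \<open>(-1, 1)\<close>, so that the number of
  roots there, with multiplicity, plus the number of these conditions is at most \<open>degree Q\<close>
  (\<open>root_count_plus_conditions_le_degree\<close>). If \<open>Q\<close> has least degree among all solutions, then
  \<open>degree Q\<close> is in turn at most \<open>m\<close> plus the number of the same conditions. Hence there are at most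
  \<open>m\<close> roots, and the \<open>m\<close> prescribed ones are simple and the only ones
  (\<open>exists_poly_with_prescribed_simple_roots\<close>).
\<close>

section \<open>Common kernels of linear functionals\<close>

definition linear_functional :: "('a::field poly \<Rightarrow> 'a) \<Rightarrow> bool" where
  "linear_functional L \<longleftrightarrow>
     (\<forall>p q. L (p + q) = L p + L q) \<and> (\<forall>a p. L (smult a p) = a * L p)"

text \<open>Zero is left out because its degree is \<open>0\<close> by convention and would spoil the count of degrees.\<close>

definition common_kernel :: "('a::field poly \<Rightarrow> 'a) set \<Rightarrow> 'a poly set" where
  "common_kernel F = {p. p \<noteq> 0 \<and> (\<forall>L\<in>F. L p = 0)}"

lemma linear_functional_eval_higher_pderiv:
  "linear_functional (\<lambda>p :: 'a::field poly. poly ((pderiv ^^ k) p) x)"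
  by (simp add: linear_functional_def higher_pderiv_add higher_pderiv_smult)

lemma linear_functional_expand_monom:
  assumes "linear_functional L"
  shows "L p = (\<Sum>i\<le>degree p. coeff p i * L (monom 1 i))"
proof -
  have L0: "L 0 = 0"
    using assms[unfolded linear_functional_def] by (metis mult_zero_left smult_0_left)
  have sum: "L (sum g A) = (\<Sum>i\<in>A. L (g i))" if "finite A" for g and A :: "nat set"
    using that assms L0 by (induction A) (auto simp: linear_functional_def)
  have "L p = L (\<Sum>i\<le>degree p. smult (coeff p i) (monom 1 i))"
    by (simp add: smult_monom poly_as_sum_of_monoms)
  also have "\<dots> = (\<Sum>i\<le>degree p. coeff p i * L (monom 1 i))"
    using assms by (subst sum) (simp_all add: linear_functional_def)
  finally show ?thesis .
qed

text \<open>This sharpens the count of unknowns against equations so that it can be proved by induction on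
  the number of functionals. Each functional costs at most one degree. If \<open>p\<close> has the smallest degree lost by adding \<open>L\<close>,
  then \<open>L p \<noteq> 0\<close>, and any \<open>q\<close> of larger degree in the old kernel can be corrected by a multiple of
  \<open>p\<close> without changing its degree.\<close>

lemma common_kernel_missing_degrees:
  assumes "finite F" and "\<forall>L\<in>F. linear_functional L"
  shows "finite (- degree ` common_kernel F) \<and> card (- degree ` common_kernel F) \<le> card F"
  using assms
proof (induction F rule: finite_induct)
  case empty
  have "degree ` common_kernel ({} :: ('a poly \<Rightarrow> 'a) set) = UNIV"
  proof -
    have "n \<in> degree ` common_kernel ({} :: ('a poly \<Rightarrow> 'a) set)" for n
      by (rule image_eqI[of _ _ "monom 1 n"]) (auto simp: common_kernel_def degree_monom_eq)
    then show ?thesis by blast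
  qed
  then show ?case by simp
next
  case (insert L F)
  let ?D = "degree ` common_kernel F" and ?E = "degree ` common_kernel (insert L F)"
  have lin: "L (p + q) = L p + L q" "L (smult a p) = a * L p" for a p q
    using insert.prems by (auto simp: linear_functional_def)
  have linF: "M (p + q) = M p + M q" "M (smult a p) = a * M p" if "M \<in> F" for M a p q
    using insert.prems that by (auto simp: linear_functional_def)
  have above: "b \<in> ?E" if ab: "a < b" and a: "a \<in> ?D" "a \<notin> ?E" and b: "b \<in> ?D" for a b
  proof -
    obtain p where p: "p \<in> common_kernel F" "degree p = a" using a by auto
    obtain q where q: "q \<in> common_kernel F" "degree q = b" using b by auto
    have Lp: "L p \<noteq> 0" using p a by (auto simp: common_kernel_def)
    define r where "r = smult (L p) q + smult (- L q) p"
    have deg: "degree r = b"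
      unfolding r_def using p q Lp ab by (subst degree_add_eq_left) auto
    have "L r = 0" by (simp only: r_def lin) simp
    moreover have "M r = 0" if "M \<in> F" for M
    proof -
      have "M p = 0" "M q = 0" using p q that by (auto simp: common_kernel_def)
      then show ?thesis unfolding r_def linF[OF that] by simp
    qed
    moreover have "r \<noteq> 0" using deg ab by auto
    ultimately have "r \<in> common_kernel (insert L F)"
      by (simp add: common_kernel_def)
    then show ?thesis using deg by blast
  qed
  obtain a where lost: "?D - ?E \<subseteq> {a}"
  proof (cases "?D - ?E = {}")
    case False
    then obtain a where "a \<in> ?D - ?E" by blast
    moreover have "x = y" if "x \<in> ?D - ?E" "y \<in> ?D - ?E" for x y
      using above[of x y] above[of y x] that by (meson Diff_iff linorder_neqE_nat)
    ultimately show ?thesis using that by blast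
  qed (use that in blast)
  then have sub: "- ?E \<subseteq> insert a (- ?D)" by blast
  have IH: "finite (- ?D)" "card (- ?D) \<le> card F" using insert by auto
  then have "finite (- ?E)" using sub by (meson finite_insert finite_subset)
  moreover have "card (- ?E) \<le> Suc (card F)"
  proof -
    have "card (- ?E) \<le> card (insert a (- ?D))" using IH sub by (intro card_mono) auto
    also have "\<dots> \<le> Suc (card (- ?D))" by (rule card_insert_le_m1) auto
    finally show ?thesis using IH by simp
  qed
  ultimately show ?case using insert.hyps by simp
qed

lemma common_kernel_degree_bound:
  assumes "finite F" and "\<forall>L\<in>F. linear_functional L"
  shows "\<exists>p\<in>common_kernel F. degree p \<le> card F"
proof (rule ccontr)
  assume "\<not> ?thesis"
  then have "{..card F} \<subseteq> - degree ` common_kernel F" by force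
  then have "card {..card F} \<le> card (- degree ` common_kernel F)"
    using common_kernel_missing_degrees[OF assms] by (intro card_mono) auto
  then show False using common_kernel_missing_degrees[OF assms] by simp
qed

section \<open>Counting real roots with multiplicity\<close>

definition root_count :: "real poly \<Rightarrow> real set \<Rightarrow> nat" where
  "root_count p A = (\<Sum>x\<in>{x\<in>A. poly p x = 0}. order x p)"

lemma root_count_ge_sum:
  assumes "p \<noteq> 0" "finite T" "T \<subseteq> A"
  shows "(\<Sum>x\<in>T. order x p) \<le> root_count p A"
proof -
  have "(\<Sum>x\<in>T. order x p) = (\<Sum>x\<in>{x\<in>T. poly p x = 0}. order x p)"
    using assms by (intro sum.mono_neutral_right) (auto simp: order_root)
  also have "\<dots> \<le> root_count p A"
    unfolding root_count_def using assms poly_roots_finite[OF assms(1)]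
    by (intro sum_mono2) (auto intro: finite_subset)
  finally show ?thesis .
qed

lemma root_count_add_roots:
  assumes "p \<noteq> 0" "finite R" "A \<inter> R = {}" "A \<union> R \<subseteq> B" "\<forall>x\<in>R. poly p x = 0"
  shows "root_count p A + card R \<le> root_count p B"
proof -
  let ?Z = "{x\<in>A. poly p x = 0}"
  have fin: "finite ?Z" using poly_roots_finite[OF assms(1)] by (rule finite_subset[rotated]) auto
  have "card R = (\<Sum>x\<in>R. 1)" by simp
  also have "\<dots> \<le> (\<Sum>x\<in>R. order x p)"
    using assms by (intro sum_mono) (auto simp: order_root Suc_le_eq)
  finally have "root_count p A + card R \<le> (\<Sum>x\<in>?Z \<union> R. order x p)"
    using fin assms by (subst sum.union_disjoint) (auto simp: root_count_def)
  also have "\<dots> \<le> root_count p B" using fin assms by (intro root_count_ge_sum) auto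
  finally show ?thesis .
qed

lemma Rolle_roots_between:
  fixes p :: "real poly"
  assumes "finite Z" "\<forall>x\<in>Z. poly p x = 0" and "Z \<noteq> {}"
  shows "\<exists>B. finite B \<and> B \<subseteq> convex hull Z \<and> B \<inter> Z = {} \<and> card Z \<le> Suc (card B) \<and>
           (\<forall>x\<in>B. poly (pderiv p) x = 0)"
  using assms
proof (induction Z rule: finite_linorder_max_induct)
  case empty
  then show ?case by simp
next
  case (insert b Z)
  show ?case
  proof (cases "Z = {}")
    case True
    then show ?thesis by (intro exI[of _ "{}"]) simp
  next
    case False
    then obtain B where B: "finite B" "B \<subseteq> convex hull Z" "B \<inter> Z = {}" "card Z \<le> Suc (card B)"
      "\<forall>x\<in>B. poly (pderiv p) x = 0" using insert by auto
    define a where "a = Max Z"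
    have a: "a \<in> Z" "\<forall>z\<in>Z. z \<le> a" using False insert by (auto simp: a_def)
    then have "a < b" using insert by auto
    then obtain c where c: "a < c" "c < b" "poly (pderiv p) c = 0"
      using poly_MVT[of a b p] insert.prems a by auto
    have "convex hull Z \<subseteq> {..a}" using a by (intro hull_minimal) auto
    then have Bc: "\<forall>x\<in>B. x \<le> a" using B by auto
    have "c \<in> convex hull {a, b}"
      using c by (simp add: convex_hull_eq_real_cbox cbox_interval)
    also have "\<dots> \<subseteq> convex hull (insert b Z)" using a by (intro hull_mono) auto
    finally have ch: "c \<in> convex hull (insert b Z)" .
    have BZ: "B \<subseteq> convex hull (insert b Z)" using B(2) hull_mono[of Z "insert b Z" convex] by auto
    have "card (insert b Z) = Suc (card Z)" using insert by auto
    moreover have "card (insert c B) = Suc (card B)" using Bc c B by (subst card_insert_disjoint) auto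
    ultimately have "card (insert b Z) \<le> Suc (card (insert c B))" using B by simp
    moreover have "insert c B \<inter> insert b Z = {}"
    proof -
      have "c \<notin> Z" "c \<noteq> b" "b \<notin> B" using a c Bc \<open>a < b\<close> by auto
      then show ?thesis using B by blast
    qed
    ultimately show ?thesis using B BZ ch c by (intro exI[of _ "insert c B"]) simp
  qed
qed

text \<open>Differentiation lowers the order of each root by one, and the roots between neighbouring
  roots make good for all of these losses but one.\<close>

lemma root_count_pderiv:
  assumes "pderiv p \<noteq> 0" "convex A"
  shows "root_count p A \<le> Suc (root_count (pderiv p) A)"
proof -
  let ?Z = "{x\<in>A. poly p x = 0}"
  have p0: "p \<noteq> 0" using assms by auto
  have fin: "finite ?Z" using poly_roots_finite[OF p0] by (rule finite_subset[rotated]) auto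
  show ?thesis
  proof (cases "?Z = {}")
    case True
    then show ?thesis unfolding root_count_def by (metis sum.empty le0)
  next
    case False
    then obtain B where B: "finite B" "B \<subseteq> convex hull ?Z" "B \<inter> ?Z = {}" "card ?Z \<le> Suc (card B)"
      "\<forall>x\<in>B. poly (pderiv p) x = 0" using Rolle_roots_between[OF fin, of p] by auto
    have "convex hull ?Z \<subseteq> A" using assms by (intro hull_minimal) auto
    then have BA: "B \<subseteq> A" using B by auto
    have "root_count p A = (\<Sum>x\<in>?Z. Suc (order x (pderiv p)))"
      unfolding root_count_def using p0 by (intro sum.cong) (auto intro: order_pderiv)
    also have "\<dots> = (\<Sum>x\<in>?Z. order x (pderiv p)) + card ?Z"
      by (simp add: sum_Suc)
    also have "\<dots> \<le> Suc ((\<Sum>x\<in>?Z. order x (pderiv p)) + card B)" using B by simp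
    also have "card B = (\<Sum>x\<in>B. 1)" by simp
    also have "(\<Sum>x\<in>B. 1) \<le> (\<Sum>x\<in>B. order x (pderiv p))"
      using B assms by (intro sum_mono) (auto simp: order_root Suc_le_eq)
    also have "(\<Sum>x\<in>?Z. order x (pderiv p)) + (\<Sum>x\<in>B. order x (pderiv p)) =
               (\<Sum>x\<in>?Z \<union> B. order x (pderiv p))"
      using fin B by (subst sum.union_disjoint) auto
    also have "\<dots> \<le> root_count (pderiv p) A"
      using fin B BA assms by (intro root_count_ge_sum) auto
    finally show ?thesis by simp
  qed
qed

text \<open>Sequential ordering is what lets Rolle's theorem accumulate. The roots of the
  \<open>v\<close>-th derivative are counted on the convex set generated by \<open>A\<close> and the \<open>r k\<close> with \<open>\<nu> k < v\<close>.
  The \<open>r k\<close> with \<open>\<nu> k = v\<close> lie outside it and differ from each other, so enlarging the set by them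
  adds one root for each. Differentiating then costs one root.\<close>

lemma root_count_higher_pderiv:
  fixes r :: "nat \<Rightarrow> real" and \<nu> :: "nat \<Rightarrow> nat"
  assumes "Q \<noteq> 0" "convex A"
    and mono: "mono_on {1..N} \<nu>"
    and out: "\<And>k. k \<in> {1..N} \<Longrightarrow> r k \<notin> convex hull (A \<union> r ` {1..<k})"
    and zero: "\<And>k. k \<in> {1..N} \<Longrightarrow> poly ((pderiv ^^ \<nu> k) Q) (r k) = 0"
    and "v \<le> degree Q"
  shows "root_count Q A + card {k\<in>{1..N}. \<nu> k < v} \<le>
         root_count ((pderiv ^^ v) Q) (convex hull (A \<union> r ` {k\<in>{1..N}. \<nu> k < v})) + v"
  using \<open>v \<le> degree Q\<close>
proof (induction v)
  case 0
  then show ?case using \<open>convex A\<close> by (simp add: hull_same)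
next
  case (Suc v)
  let ?T = "\<lambda>v. {k\<in>{1..N}. \<nu> k < v}" and ?K = "{k\<in>{1..N}. \<nu> k = v}"
  let ?C = "\<lambda>v. convex hull (A \<union> r ` ?T v)"
  let ?p = "(pderiv ^^ v) Q"
  have deg: "degree ?p = degree Q - v" by (rule degree_higher_pderiv)
  then have p': "pderiv ?p \<noteq> 0" using Suc.prems by (auto simp: pderiv_eq_0_iff)
  then have p: "?p \<noteq> 0" by auto
  have T: "?T (Suc v) = ?T v \<union> ?K" by auto
  have inj: "inj_on r ?K"
  proof (rule linorder_inj_onI)
    fix i k assume "i < k" "i \<in> ?K" "k \<in> ?K"
    then have "r i \<in> convex hull (A \<union> r ` {1..<k})" by (intro hull_inc) auto
    then show "r i \<noteq> r k" using out[of k] \<open>k \<in> ?K\<close> by auto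
  qed auto
  have disj: "?C v \<inter> r ` ?K = {}"
  proof -
    have "r k \<notin> ?C v" if k: "k \<in> ?K" for k
    proof -
      have "i < k" if "i \<in> ?T v" for i
        using mono_onD[OF mono, of k i] k that by (cases "i < k") auto
      then have "?C v \<subseteq> convex hull (A \<union> r ` {1..<k})" by (intro hull_mono) auto
      then show ?thesis using out[of k] k by auto
    qed
    then show ?thesis by blast
  qed
  have "r ` ?K \<subseteq> ?C (Suc v)" unfolding T by (intro subset_trans[OF _ hull_subset]) auto
  moreover have "?C v \<subseteq> ?C (Suc v)" unfolding T by (intro hull_mono) auto
  ultimately have "root_count ?p (?C v) + card (r ` ?K) \<le> root_count ?p (?C (Suc v))"
    using p disj zero by (intro root_count_add_roots) auto
  also have "\<dots> \<le> Suc (root_count (pderiv ?p) (?C (Suc v)))"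
    using p' by (intro root_count_pderiv) auto
  finally have step: "root_count ?p (?C v) + card ?K \<le> Suc (root_count (pderiv ?p) (?C (Suc v)))"
    unfolding card_image[OF inj] .
  have "card (?T (Suc v)) = card (?T v) + card ?K"
    unfolding T by (subst card_Un_disjoint) auto
  then show ?case using Suc.IH Suc.prems step by simp
qed

corollary root_count_plus_conditions_le_degree:
  fixes r :: "nat \<Rightarrow> real" and \<nu> :: "nat \<Rightarrow> nat"
  assumes "Q \<noteq> 0" "convex A" "mono_on {1..N} \<nu>"
    and "\<And>k. k \<in> {1..N} \<Longrightarrow> r k \<notin> convex hull (A \<union> r ` {1..<k})"
    and "\<And>k. k \<in> {1..N} \<Longrightarrow> poly ((pderiv ^^ \<nu> k) Q) (r k) = 0"
  shows "root_count Q A + card {k\<in>{1..N}. \<nu> k < degree Q} \<le> degree Q"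
proof -
  let ?p = "(pderiv ^^ degree Q) Q"
  have "degree ?p = 0" by (simp add: degree_higher_pderiv)
  moreover have "coeff ?p 0 \<noteq> 0" using \<open>Q \<noteq> 0\<close> by (simp add: coeff_higher_pderiv pochhammer_eq_0_iff)
  ultimately have "poly ?p x \<noteq> 0" for x by (simp add: poly_altdef)
  then have "root_count ?p C = 0" for C by (simp add: root_count_def)
  then show ?thesis using root_count_higher_pderiv[OF assms order_refl] by simp
qed

section \<open>Sign changes and orders of roots\<close>

text \<open>Near \<open>x\<close> the cofactor of \<open>(y - x) ^ order x p\<close> keeps its sign, so only the parity of the
  exponent decides.\<close>

lemma changes_sign_at_iff_odd_order:
  fixes p :: "real poly"
  assumes "p \<noteq> 0"
  shows "changes_sign_at (poly p) x \<longleftrightarrow> odd (order x p)"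
proof -
  define k where "k = order x p"
  obtain q where q: "p = [:- x, 1:] ^ k * q" "\<not> [:- x, 1:] dvd q"
    using order_decomp[OF assms, of x] by (auto simp: k_def)
  then have "poly q x \<noteq> 0" by (simp add: poly_eq_0_iff_dvd)
  have pp: "poly p y * poly p z = ((y - x) * (z - x)) ^ k * (poly q y * poly q z)" for y z
    by (simp add: q(1) power_mult_distrib)
  have "continuous (at x) (\<lambda>y. poly q y * poly q x)" by (intro continuous_intros)
  moreover have "0 < poly q x * poly q x" using \<open>poly q x \<noteq> 0\<close> by (simp add: zero_less_mult_iff linorder_neq_iff disj_commute)
  ultimately have "\<forall>\<^sub>F y in at x. poly q y * poly q x > 0"
    unfolding continuous_at by (rule order_tendstoD)
  then obtain \<delta> where \<delta>: "\<delta> > 0" "\<And>y. y \<noteq> x \<Longrightarrow> \<bar>y - x\<bar> < \<delta> \<Longrightarrow> poly q y * poly q x > 0"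
    by (auto simp: eventually_at dist_real_def)
  have qq: "poly q y * poly q z > 0"
    if "y \<noteq> x" "\<bar>y - x\<bar> < \<delta>" "z \<noteq> x" "\<bar>z - x\<bar> < \<delta>" for y z
    using \<delta>(2)[of y] \<delta>(2)[of z] that by (auto simp: zero_less_mult_iff)
  show ?thesis
  proof
    assume "odd (order x p)"
    have "poly p y * poly p z < 0" if "y \<in> {x - \<delta><..<x}" "z \<in> {x<..<x + \<delta>}" for y z
    proof -
      have "(y - x) * (z - x) < 0" using that by (auto simp: mult_less_0_iff)
      then have "((y - x) * (z - x)) ^ k < 0" using \<open>odd _\<close> by (simp add: k_def power_less_zero_eq)
      then show ?thesis unfolding pp using qq[of y z] that by (simp add: mult_less_0_iff)
    qed
    then show "changes_sign_at (poly p) x" using \<open>\<delta> > 0\<close> by (auto simp: changes_sign_at_def)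
  next
    assume "changes_sign_at (poly p) x"
    then obtain \<epsilon> where \<epsilon>: "\<epsilon> > 0"
      "\<And>y z. y \<in> {x - \<epsilon><..<x} \<Longrightarrow> z \<in> {x<..<x + \<epsilon>} \<Longrightarrow> poly p y * poly p z < 0"
      by (auto simp: changes_sign_at_def)
    define h where "h = min \<epsilon> \<delta> / 2"
    have h: "0 < h" "h < \<epsilon>" "h < \<delta>" using \<epsilon>(1) \<delta>(1) by (auto simp: h_def)
    have "poly p (x - h) * poly p (x + h) < 0" using h by (intro \<epsilon>(2)) auto
    moreover have "poly q (x - h) * poly q (x + h) > 0" using h by (intro qq) auto
    ultimately have "((x - h - x) * (x + h - x)) ^ k < 0"
      unfolding pp by (meson mult_less_0_iff order_less_asym)
    then show "odd (order x p)" by (auto simp: k_def power_less_zero_eq)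
  qed
qed

text \<open>Squared linear factors can be split off without affecting the sign until no root is left in the
  open interval; the intermediate value theorem then excludes a change of sign up to the end points.\<close>

lemma semidefinite_if_even_orders:
  fixes p :: "real poly"
  assumes "p \<noteq> 0" "a < b" and "\<And>x. a < x \<Longrightarrow> x < b \<Longrightarrow> even (order x p)"
  shows "\<exists>s. s \<noteq> 0 \<and> (\<forall>x\<in>{a..b}. 0 \<le> s * poly p x)"
  using assms
proof (induction "degree p" arbitrary: p rule: less_induct)
  case less
  show ?case
  proof (cases "\<exists>x. a < x \<and> x < b \<and> poly p x = 0")
    case True
    then obtain r where r: "a < r" "r < b" "poly p r = 0" by blast
    have "order r p \<noteq> 0" using r less.prems by (simp add: order_root)
    moreover have "even (order r p)" using r less.prems by blast
    ultimately have "2 \<le> order r p" by (cases "order r p"; cases "order r p - 1") auto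
    then have "[:- r, 1:] ^ 2 dvd p" by (simp add: order_divides)
    then obtain q where q: "p = [:- r, 1:] ^ 2 * q" ..
    have q0: "q \<noteq> 0" using less.prems q by auto
    have "degree p = 2 + degree q" unfolding q using q0 by (simp add: degree_mult_eq degree_power_eq)
    moreover have "even (order x q)" if "a < x" "x < b" for x
    proof -
      have "order x p = 2 * order x [:- r, 1:] + order x q"
        unfolding q power2_eq_square mult.assoc using q0 by (simp add: order_mult del: mult_pCons_left)
      moreover have "even (order x p)" using less.prems(3) that by blast
      ultimately show ?thesis by presburger
    qed
    ultimately obtain s where "s \<noteq> 0" "\<forall>x\<in>{a..b}. 0 \<le> s * poly q x"
      using less.hyps[of q] q0 less.prems(2) by auto
    moreover have "s * poly p x = (x - r)\<^sup>2 * (s * poly q x)" for x by (simp add: q poly_power)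
    ultimately show ?thesis by (intro exI[of _ s]) (metis mult_nonneg_nonneg zero_le_power2)
  next
    case False
    define c where "c = (a + b) / 2"
    have c: "a < c" "c < b" using less.prems by (auto simp: c_def)
    have "0 \<le> poly p c * poly p x" if "x \<in> {a..b}" for x
    proof (rule ccontr)
      assume neg: "\<not> ?thesis"
      then have "x \<noteq> c" by auto
      then show False
        using neg poly_IVT[of x c p] poly_IVT[of c x p] False c that
        by (cases "x < c") (fastforce simp: mult.commute)+
    qed
    then show ?thesis using False c by blast
  qed
qed

section \<open>The measure and the Sobolev form\<close>

lemma set_integrable_poly:
  fixes M :: "real measure"
  assumes "finite_measure M" "sets M = sets borel"
  shows "set_integrable M {a..b} (poly p)"
proof -
  interpret finite_measure M by fact
  have "bounded (poly p ` {a..b})"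
    by (intro compact_imp_bounded compact_continuous_image continuous_intros) auto
  then obtain B where B: "\<And>x. x \<in> {a..b} \<Longrightarrow> \<bar>poly p x\<bar> \<le> B"
    unfolding bounded_iff by fastforce
  have "integrable M (\<lambda>x. indicator {a..b} x *\<^sub>R poly p x)"
  proof (rule integrable_const_bound[where B = "\<bar>B\<bar>"])
    show "AE x in M. norm (indicator {a..b} x *\<^sub>R poly p x) \<le> \<bar>B\<bar>"
      using B by (intro AE_I2) (force simp: indicator_def)
    have "(\<lambda>x. indicator {a..b} x *\<^sub>R poly p x) \<in> borel_measurable borel"
      by (intro borel_measurable_scaleR borel_measurable_indicator borel_measurable_continuous_onI
          continuous_intros) auto
    then show "(\<lambda>x. indicator {a..b} x *\<^sub>R poly p x) \<in> borel_measurable M"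
      by (simp cong: measurable_cong_sets add: assms(2))
  qed
  then show ?thesis by (simp add: set_integrable_def)
qed

text \<open>An infinite support contains a point inside the interval at which \<open>p\<close> does not vanish, hence a
  neighbourhood of positive measure on which \<open>p\<close> is positive.\<close>

lemma integral_poly_pos:
  fixes M :: "real measure"
  assumes "finite_measure M" "sets M = sets borel"
    and supp: "measure_supp M \<subseteq> {a..b}" "infinite (measure_supp M)"
    and "p \<noteq> 0" and nonneg: "\<And>x. x \<in> {a..b} \<Longrightarrow> 0 \<le> poly p x"
  shows "0 < (LINT x:{a..b}|M. poly p x)"
proof -
  have "finite ({a, b} \<union> {x. poly p x = 0})" using \<open>p \<noteq> 0\<close> by (simp add: poly_roots_finite)
  then have "\<not> measure_supp M \<subseteq> {a, b} \<union> {x. poly p x = 0}" using supp(2) finite_subset by blast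
  then obtain x where x: "x \<in> measure_supp M" "x \<noteq> a" "x \<noteq> b" "poly p x \<noteq> 0" by blast
  define U where "U = {y. poly p y \<noteq> 0} \<inter> {a<..<b}"
  have "open {y. poly p y \<noteq> 0}" by (intro open_Collect_neq continuous_intros)
  then have "open U" by (auto simp: U_def)
  moreover have "x \<in> U" using x supp(1) by (force simp: U_def)
  ultimately have "emeasure M U > 0" using x(1) by (auto simp: measure_supp_def)
  let ?f = "\<lambda>x. indicator {a..b} x *\<^sub>R poly p x"
  have int: "integrable M ?f"
    using set_integrable_poly[OF assms(1,2)] by (simp add: set_integrable_def)
  have f0: "0 \<le> ?f x" for x using nonneg by (auto simp: indicator_def)
  have "integral\<^sup>L M ?f \<noteq> 0"
  proof
    assume "integral\<^sup>L M ?f = 0"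
    then have "AE x in M. ?f x = 0"
      using integral_nonneg_eq_0_iff_AE[OF int] f0 by simp
    then have "AE x in M. x \<notin> U" by eventually_elim (auto simp: U_def indicator_def)
    then have "emeasure M U = 0" using \<open>open U\<close> assms(2) sets_eq_imp_space_eq[OF assms(2)]
      by (subst (asm) AE_iff_measurable[of U]) auto
    then show False using \<open>emeasure M U > 0\<close> by simp
  qed
  moreover have "integral\<^sup>L M ?f \<ge> 0" using f0 by (intro integral_nonneg_AE) auto
  ultimately show ?thesis by (simp add: set_lebesgue_integral_def)
qed

lemma linear_functional_sobolev_inner:
  assumes "finite_measure M" "sets M = sets borel"
  shows "linear_functional (\<lambda>p. sobolev_inner M N \<eta> c d p S)"
proof -
  have int: "set_integrable M {-1..1} (\<lambda>x. poly p x * poly S x)" for p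
    using set_integrable_poly[OF assms, of "-1" 1 "p * S"] by (simp add: set_integrable_def)
  have add: "sobolev_inner M N \<eta> c d (p + q) S = sobolev_inner M N \<eta> c d p S + sobolev_inner M N \<eta> c d q S"
    for p q
    using set_integral_add(2)[OF int[of p] int[of q]]
    by (simp add: sobolev_inner_def higher_pderiv_add sum.distrib algebra_simps)
  have scale: "sobolev_inner M N \<eta> c d (smult a p) S = a * sobolev_inner M N \<eta> c d p S" for a p
    unfolding sobolev_inner_def
    by (simp add: higher_pderiv_smult sum_distrib_left distrib_left mult.assoc mult.left_commute)
  show ?thesis unfolding linear_functional_def using add scale by blast
qed

section \<open>The test polynomial\<close>

text \<open>Take a polynomial of least degree that satisfies all conditions. Minimality bounds its degree
  above: conditions of order at least \<open>degree Q\<close> would hold automatically for a polynomial of smaller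
  degree, so only the others count. Exactly these count in the Rolle bound too, and comparing the two
  leaves no room in \<open>A\<close> for roots beyond simple ones on \<open>X\<close>.\<close>

lemma exists_poly_with_prescribed_simple_roots:
  fixes r :: "nat \<Rightarrow> real" and \<nu> :: "nat \<Rightarrow> nat"
  assumes "finite X" "X \<subseteq> A" "convex A" and mono: "mono_on {1..N} \<nu>"
    and out: "\<And>k. k \<in> {1..N} \<Longrightarrow> r k \<notin> convex hull (A \<union> r ` {1..<k})"
  shows "\<exists>Q. Q \<noteq> 0 \<and> degree Q \<le> card X + N \<and>
    (\<forall>k\<in>{1..N}. poly ((pderiv ^^ \<nu> k) Q) (r k) = 0) \<and>
    (\<forall>x\<in>A. order x Q = (if x \<in> X then 1 else 0))"
proof -
  define G where "G K = (\<lambda>x p. poly p x) ` X \<union> (\<lambda>k p. poly ((pderiv ^^ \<nu> k) p) (r k)) ` K" for K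
  have finG: "finite (G K)" if "finite K" for K using that \<open>finite X\<close> by (simp add: G_def)
  have linG: "\<forall>L\<in>G K. linear_functional L" for K
    using linear_functional_eval_higher_pderiv[of 0]
    by (auto simp: G_def intro: linear_functional_eval_higher_pderiv)
  have cardG: "card (G K) \<le> card X + card K" if "finite K" for K
    unfolding G_def using that \<open>finite X\<close>
    by (intro order_trans[OF card_Un_le] add_mono card_image_le)
  obtain Q\<^sub>0 where "Q\<^sub>0 \<in> common_kernel (G {1..N})"
    using common_kernel_degree_bound[OF finG linG, of "{1..N}"] by auto
  then obtain Q where Q: "Q \<in> common_kernel (G {1..N})"
    and least: "\<And>p. p \<in> common_kernel (G {1..N}) \<Longrightarrow> degree Q \<le> degree p"
    using ex_has_least_nat[of "\<lambda>p. p \<in> common_kernel (G {1..N})" Q\<^sub>0 degree] by blast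
  have Q0: "Q \<noteq> 0" and QX: "\<And>x. x \<in> X \<Longrightarrow> poly Q x = 0"
    and Qr: "\<And>k. k \<in> {1..N} \<Longrightarrow> poly ((pderiv ^^ \<nu> k) Q) (r k) = 0"
    using Q by (auto simp: common_kernel_def G_def)
  define K where "K = {k\<in>{1..N}. \<nu> k < degree Q}"
  have finK: "finite K" by (simp add: K_def)
  \<comment> \<open>Otherwise dropping the automatic conditions would yield a solution of smaller degree.\<close>
  have upper: "degree Q \<le> card X + card K"
  proof (rule ccontr)
    assume contra: "\<not> ?thesis"
    obtain R where R: "R \<in> common_kernel (G K)" "degree R \<le> card (G K)"
      using common_kernel_degree_bound[OF finG[OF finK] linG] by blast
    then have less: "degree R < degree Q" using cardG[OF finK] contra by linarith
    have "poly ((pderiv ^^ \<nu> k) R) (r k) = 0" if "k \<in> {1..N}" for k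
    proof (cases "k \<in> K")
      case True
      then show ?thesis using R by (auto simp: common_kernel_def G_def)
    next
      case False
      then have "degree R < \<nu> k" using less that by (auto simp: K_def)
      then have "(pderiv ^^ \<nu> k) R = 0" by (simp add: poly_eq_iff coeff_higher_pderiv coeff_eq_0)
      then show ?thesis by simp
    qed
    then have "R \<in> common_kernel (G {1..N})" using R by (auto simp: common_kernel_def G_def)
    then show False using least less by fastforce
  qed
  have rc: "root_count Q A \<le> card X"
    using root_count_plus_conditions_le_degree[OF Q0 \<open>convex A\<close> mono out Qr] upper
    by (simp add: K_def)
  have ord1: "1 \<le> order x Q" if "x \<in> X" for x using QX[OF that] Q0 by (simp add: order_root Suc_le_eq)
  \<comment> \<open>The roots in \<open>X\<close> already use up the bound \<open>rc\<close>, so neither a multiple root nor a further one fits.\<close>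
  have "order x Q = (if x \<in> X then 1 else 0)" if x: "x \<in> A" for x
  proof -
    have "(\<Sum>y\<in>insert x X. order y Q) \<le> card X"
      using root_count_ge_sum[of Q "insert x X" A] Q0 assms x rc by simp
    moreover have "card (X - {x}) \<le> (\<Sum>y\<in>X - {x}. order y Q)"
      using sum_mono[of "X - {x}" "\<lambda>_. 1" "\<lambda>y. order y Q"] ord1 by simp
    ultimately have "order x Q + card (X - {x}) \<le> card X"
      using \<open>finite X\<close> by (simp add: sum.insert_remove)
    then show ?thesis using ord1[of x] \<open>finite X\<close>
      by (cases "x \<in> X") (auto simp: card_Diff_singleton_if)
  qed
  moreover have "degree Q \<le> card X + N"
  proof -
    have "card K \<le> card {1..N}" unfolding K_def by (intro card_mono) auto
    then show ?thesis using upper by simp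
  qed
  ultimately show ?thesis using Q0 Qr by blast
qed

section \<open>Sign changes of Sobolev orthogonal polynomials\<close>

theorem theorem1:
  fixes \<mu> :: "real measure" and N n :: nat
    and \<eta> c :: "nat \<Rightarrow> real" and d :: "nat \<Rightarrow> nat" and S :: "real poly"
  assumes "finite_measure \<mu>" and "sets \<mu> = sets borel"
    and "measure_supp \<mu> \<subseteq> {-1..1}" and "infinite (measure_supp \<mu>)"
    and "\<And>j. j \<in> {1..N} \<Longrightarrow> \<eta> j > 0"
    and "\<And>j. j \<in> {1..N} \<Longrightarrow> c j \<notin> {-1..1}"
    and "sequentially_ordered N c d"
    and "degree S = n" and "lead_coeff S = 1"
    and "\<And>k. k < n \<Longrightarrow> sobolev_inner \<mu> N \<eta> c d (monom 1 k) S = 0"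
  shows "int (num_sign_changes (poly S) {-1<..<1}) \<ge> int n - int N"
proof (rule ccontr)
  assume contra: "\<not> ?thesis"
  define X where "X = {x \<in> {-1<..<1}. changes_sign_at (poly S) x}"
  have few: "card X + N < n" using contra by (simp add: num_sign_changes_def X_def)
  have S0: "S \<noteq> 0" using \<open>lead_coeff S = 1\<close> by auto
  have X: "x \<in> X \<longleftrightarrow> x \<in> {-1<..<1} \<and> odd (order x S)" for x
    by (simp add: X_def changes_sign_at_iff_odd_order[OF S0])
  have "poly S x = 0" if "x \<in> X" for x using that X[of x] order_0I[of S x] by fastforce
  then have "finite X" by (intro finite_subset[OF _ poly_roots_finite[OF S0]]) blast
  have "X \<subseteq> {-1<..<1}" by (auto simp: X_def)
  obtain \<sigma> where \<sigma>: "bij_betw \<sigma> {1..N} {1..N}" "mono_on {1..N} (\<lambda>k. d (\<sigma> k))"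
    "\<And>k. k \<in> {1..N} \<Longrightarrow> c (\<sigma> k) \<notin> convex hull ({-1<..<1} \<union> (\<lambda>i. c (\<sigma> i)) ` {1..<k})"
    using \<open>sequentially_ordered N c d\<close> by (auto simp: sequentially_ordered_def)
  have "\<exists>Q. Q \<noteq> 0 \<and> degree Q \<le> card X + N \<and>
      (\<forall>k\<in>{1..N}. poly ((pderiv ^^ d (\<sigma> k)) Q) (c (\<sigma> k)) = 0) \<and>
      (\<forall>x\<in>{-1<..<1}. order x Q = (if x \<in> X then 1 else 0))"
    using \<open>finite X\<close> \<open>X \<subseteq> {-1<..<1}\<close> \<sigma>(2,3)
    by (intro exists_poly_with_prescribed_simple_roots convex_real_interval(8))
  then obtain Q where Q: "Q \<noteq> 0" "degree Q \<le> card X + N"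
    and Q\<sigma>: "\<And>k. k \<in> {1..N} \<Longrightarrow> poly ((pderiv ^^ d (\<sigma> k)) Q) (c (\<sigma> k)) = 0"
    and ord: "\<And>x. x \<in> {-1<..<1} \<Longrightarrow> order x Q = (if x \<in> X then 1 else 0)"
    by blast
  have Qj: "poly ((pderiv ^^ d j) Q) (c j) = 0" if "j \<in> {1..N}" for j
  proof -
    have "j \<in> \<sigma> ` {1..N}" unfolding bij_betw_imp_surj_on[OF \<sigma>(1)] by (rule that)
    then obtain k where "k \<in> {1..N}" "j = \<sigma> k" by (auto elim: imageE)
    then show ?thesis using Q\<sigma> by simp
  qed
  have "even (order x (Q * S))" if "-1 < x" "x < 1" for x
    using that ord[of x] X[of x] Q(1) S0 by (simp add: order_mult split: if_splits)
  then obtain s where s: "s \<noteq> 0" "\<And>x. x \<in> {-1..1} \<Longrightarrow> 0 \<le> s * poly (Q * S) x"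
    using semidefinite_if_even_orders[of "Q * S" "-1" 1] Q(1) S0 by auto
  \<comment> \<open>The factor \<open>s\<close> normalises the sign so that the integrand is nonnegative.\<close>
  define P where "P = smult s Q"
  have "0 < (LINT x:{-1..1}|\<mu>. poly (P * S) x)"
    using assms(1-4) Q(1) S0 s by (intro integral_poly_pos) (auto simp: P_def mult.assoc)
  also have "\<dots> = sobolev_inner \<mu> N \<eta> c d P S"
    using Qj by (simp add: sobolev_inner_def P_def higher_pderiv_smult mult.assoc)
  also have "\<dots> = (\<Sum>i\<le>degree P. coeff P i * sobolev_inner \<mu> N \<eta> c d (monom 1 i) S)"
    by (rule linear_functional_expand_monom[OF linear_functional_sobolev_inner[OF assms(1,2)]])
  also have "\<dots> = 0"
    using Q(2) few s(1) assms(10) by (intro sum.neutral) (auto simp: P_def)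
  finally show False by simp
qed

end
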